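(* For any finite simple undirected graph $G$ of order $n\ge 1$, $\kappa'(G)\ge \frac{n}{n-\delta}$, where $\delta$ is the minimum degree of $G$.
   Context: For a graph $G=(V,E)$ and $C\subseteq V$, let $Odd(C)=\{v\in V : |N(v)\cap C|\equiv 1 \pmod 2\}$, where $N(v)$ is the open neighborhood of $v$. A set $B\subseteq V$ is a weak odd dominated (WOD) set if there exists $C\subseteq V\setminus B$ with $B\subseteq Odd(C)$. $\kappa'(G)$ is the minimum size of a subset of $V$ that is not a WOD set. *)

theory Defs
  imports Complex_Main "Graph_Theory.Digraph"
begin

text \<open>
  The library locale \<^locale>\<open>graph\<close> represents a finite simple undirected graph as a finite
  loop-free digraph with a symmetric arc relation and no parallel arcs; an undirected edge is
  a pair of opposite arcs. The definitions below are meant for graphs of this kind.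
\<close>

definition neighborhood :: "('a, 'b) pre_digraph \<Rightarrow> 'a \<Rightarrow> 'a set" where
  "neighborhood G v = {u \<in> verts G. v \<rightarrow>\<^bsub>G\<^esub> u}"

definition min_degree :: "('a, 'b) pre_digraph \<Rightarrow> nat" where
  "min_degree G = Min ((\<lambda>v. card (neighborhood G v)) ` verts G)"

definition Odd :: "('a, 'b) pre_digraph \<Rightarrow> 'a set \<Rightarrow> 'a set" where
  "Odd G C = {v \<in> verts G. odd (card (neighborhood G v \<inter> C))}"

definition wod_set :: "('a, 'b) pre_digraph \<Rightarrow> 'a set \<Rightarrow> bool" where
  "wod_set G B \<longleftrightarrow> B \<subseteq> verts G \<and> (\<exists>C. C \<subseteq> verts G - B \<and> B \<subseteq> Odd G C)"

text \<open>
  The minimum below is over a nonempty set as soon as the finite graph has a vertex: the whole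
  vertex set is then not a WOD set, as only the empty set is available for \<open>C\<close>.
\<close>

definition kappa' :: "('a, 'b) pre_digraph \<Rightarrow> nat" where
  "kappa' G = Min (card ` {B. B \<subseteq> verts G \<and> \<not> wod_set G B})"

end

theory Submission
  imports Defs
begin

text \<open>
  Let \<open>B\<close> be a set that is not WOD. Every vertex is a non-neighbour of some vertex of \<open>B\<close>:
  a vertex of \<open>B\<close> is a non-neighbour of itself, and if some \<open>v \<notin> B\<close> were adjacent to all of \<open>B\<close>,
  then \<open>C = {v}\<close> would show that \<open>B\<close> is WOD. A vertex has at most \<open>n - \<delta>\<close> non-neighbours,
  itself included, so \<open>n \<le> |B| (n - \<delta>)\<close>.
\<close>

text \<open>With \<open>C = {v}\<close>, each \<open>b \<in> B\<close> has exactly one neighbour in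
  \<open>C\<close>, an odd number.\<close>

lemma wod_set_if_common_neighbor:
  assumes "B \<subseteq> verts G" "v \<in> verts G" "v \<notin> B" "\<And>b. b \<in> B \<Longrightarrow> v \<in> neighborhood G b"
  shows "wod_set G B"
proof -
  have "neighborhood G b \<inter> {v} = {v}" if "b \<in> B" for b
    using assms(4)[OF that] by blast
  then have "B \<subseteq> Odd G {v}"
    using assms(1) by (auto simp: Odd_def)
  then show ?thesis
    using assms unfolding wod_set_def by blast
qed

lemma not_wod_set_verts:
  assumes "verts G \<noteq> {}"
  shows "\<not> wod_set G (verts G)"
  using assms by (auto simp: wod_set_def Odd_def)

lemma (in fin_digraph) min_degree_le:
  assumes "v \<in> verts G"
  shows "min_degree G \<le> card (neighborhood G v)"
  using assms by (simp add: min_degree_def)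

text \<open>Union bound over the sets of non-neighbours of the elements of \<open>B\<close>, in
  product form to avoid division.\<close>

lemma (in digraph) card_verts_le_non_wod:
  assumes B: "B \<subseteq> verts G" "\<not> wod_set G B"
  shows "card (verts G) \<le> card B * (card (verts G) - min_degree G)"
proof -
  have "verts G \<subseteq> (\<Union>b\<in>B. verts G - neighborhood G b)"
  proof
    fix v assume v: "v \<in> verts G"
    \<comment> \<open>Absence of loops settles the case \<open>v \<in> B\<close>: \<open>v\<close>
      itself serves as \<open>b\<close>.\<close>
    have "v \<notin> neighborhood G v"
      using adj_not_same by (auto simp: neighborhood_def)
    then show "v \<in> (\<Union>b\<in>B. verts G - neighborhood G b)"
      using wod_set_if_common_neighbor[OF B(1) v] B(2) v by blast
  qed
  then have "card (verts G) \<le> card (\<Union>b\<in>B. verts G - neighborhood G b)"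
    using B(1) by (intro card_mono finite_UN_I) (auto intro: finite_subset)
  also have "\<dots> \<le> (\<Sum>b\<in>B. card (verts G - neighborhood G b))"
    using B(1) by (intro card_UN_le) (auto intro: finite_subset)
  also have "\<dots> \<le> (\<Sum>b\<in>B. card (verts G) - min_degree G)"
  proof (rule sum_mono)
    fix b assume "b \<in> B"
    moreover have "neighborhood G b \<subseteq> verts G"
      by (auto simp: neighborhood_def)
    ultimately show "card (verts G - neighborhood G b) \<le> card (verts G) - min_degree G"
      using B(1) min_degree_le[of b] by (simp add: card_Diff_subset finite_subset diff_le_mono2 subsetD)
  qed
  finally show ?thesis by simp
qed

text \<open>The family lies in \<open>Pow (verts G)\<close> and contains \<open>verts G\<close>, so
  its \<open>Min\<close> is attained.\<close>

lemma (in fin_digraph) kappa'_attained: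
  assumes "verts G \<noteq> {}"
  obtains B where "B \<subseteq> verts G" "\<not> wod_set G B" "card B = kappa' G"
proof -
  let ?S = "{B. B \<subseteq> verts G \<and> \<not> wod_set G B}"
  have "finite ?S"
    by (rule finite_subset[of _ "Pow (verts G)"]) auto
  moreover have "?S \<noteq> {}"
    using not_wod_set_verts[OF assms] by blast
  ultimately have "kappa' G \<in> card ` ?S"
    unfolding kappa'_def by (intro Min_in) auto
  then show thesis
    using that by auto
qed

theorem lemma5:
  fixes G :: "('a, 'b) pre_digraph" and n :: nat
  assumes "graph G"
    and "card (verts G) = n"
    and "n \<ge> 1"
  shows "real (kappa' G) \<ge> real n / (real n - real (min_degree G))"
proof -
  interpret graph G by fact
  have ne: "verts G \<noteq> {}"
    using assms(2,3) by auto
  obtain B where B: "B \<subseteq> verts G" "\<not> wod_set G B" "card B = kappa' G"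
    using kappa'_attained[OF ne] by blast
  have le: "n \<le> kappa' G * (n - min_degree G)"
    using card_verts_le_non_wod[OF B(1,2)] B(3) assms(2) by simp
  \<comment> \<open>Otherwise the truncated difference is 0 and \<open>le\<close> forces
    \<open>n = 0\<close>. Hence the real denominator is positive and equals the natural
    difference.\<close>
  then have lt: "min_degree G < n"
    using assms(3) by (cases "min_degree G < n") auto
  have "real n \<le> real (kappa' G) * real (n - min_degree G)"
    using le by (metis of_nat_le_iff of_nat_mult)
  with lt show ?thesis
    by (simp add: of_nat_diff pos_divide_le_eq)
qed

end
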